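(* Let $\mathcal{G}=(B,\psi,A)$ be a finite quantum graph such that $\psi$ is a $\delta$-form and $A$ is completely positive, and let $E_{\mathcal{G}}$ be its quantum edge correspondence with cyclic vector $\varepsilon_{\mathcal{G}}$. If $1_c$ is a central projection in $B$ orthogonal to the range of $A$, then $$(1_c\cdot\varepsilon_{\mathcal{G}})\otimes\varepsilon_{\mathcal{G}}\otimes\varepsilon_{\mathcal{G}}\otimes\cdots\otimes\varepsilon_{\mathcal{G}}\in E_{\mathcal{G}}^{\otimes m}$$ is a non-returning vector.
   Context: Quantum graphs: $B$ is a finite-dimensional C*-algebra, $\psi$ a state on $B$, $L^2(B,\psi)$ is $B$ with inner product $\psi(x^*y)$, $m:L^2(B\otimes B,\psi\otimes\psi)\to L^2(B,\psi)$ is $m(x\otimes y)=xy$, and $m^*$ is its Hilbert space adjoint. For $\delta>0$, $\psi$ is a $\delta$-form if $mm^*=\delta^2\,\mathrm{id}_B$. A linear map $A:B\to B$ is quantum Schur idempotent if $m(A\otimes A)m^*=\delta^2A$. A finite quantum graph is a triple $\mathcal{G}=(B,\psi,A)$ with $A$ quantum Schur idempotent (here also completely positive). (In the claim, $m$ in $E_{\mathcal{G}}^{\otimes m}$ is a positive integer.) Quantum edge correspondence: $B\otimes_\psi B$ is $B\otimes B$ with actions $a\cdot(x\otimes y)\cdot b=ax\otimes yb$ and inner product $\langle x\otimes y\,|\,z\otimes w\rangle=y^*\psi(x^*z)w$. Put $\varepsilon_{\mathcal{G}}:=\delta^{-2}(\mathrm{id}_B\otimes A)m^*(1_B)$ and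 $E_{\mathcal{G}}:=\mathrm{Span}\{x\cdot\varepsilon_{\mathcal{G}}\cdot y:x,y\in B\}\subseteq B\otimes_\psi B$; its inner product satisfies $\langle x_1\cdot\varepsilon_{\mathcal{G}}\cdot y_1\,|\,x_2\cdot\varepsilon_{\mathcal{G}}\cdot y_2\rangle=\delta^{-2}y_1^*A(x_1^*x_2)y_2$. Non-returning vectors: for a C*-correspondence $X$ over $B$ let $(\pi,t)$ be the universal covariant Toeplitz representation of $X$ in the Cuntz–Pimsner algebra $\mathcal{O}_X$, and let $t^k:X^{\otimes k}\to\mathcal{O}_X$ be given by $t^k(\xi_1\otimes\cdots\otimes\xi_k)=t(\xi_1)\cdots t(\xi_k)$ (internal tensor powers over $B$). A vector $\xi\in X^{\otimes m}$ is non-returning if $t^m(\xi)^*t^n(\eta)t^m(\xi)=0$ whenever $0<n<m$ and $\eta\in X^{\otimes n}$. *)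

theory Defs
  imports Complex_Main "HOL-Library.Multiset" "HOL-Library.Nonpos_Ints"
begin

section \<open>C*-algebras\<close>

class scaleC =
  fixes scaleC :: "complex \<Rightarrow> 'a \<Rightarrow> 'a" (infixr \<open>*\<^sub>C\<close> 75)

class complex_vector = scaleC + ab_group_add +
  assumes scaleC_add_right: "a *\<^sub>C (x + y) = a *\<^sub>C x + a *\<^sub>C y"
    and scaleC_add_left: "(a + b) *\<^sub>C x = a *\<^sub>C x + b *\<^sub>C x"
    and scaleC_scaleC: "a *\<^sub>C b *\<^sub>C x = (a * b) *\<^sub>C x"
    and scaleC_one: "1 *\<^sub>C x = x"

class star =
  fixes star :: "'a \<Rightarrow> 'a" (\<open>(_\<^sup>\<star>)\<close> [1000] 999)

text \<open>
  Not necessarily unital C*-algebras. Only algebraic operations and the norm are class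
  parameters, so that \<open>class.cstar_algebra\<close> can also be used to quantify over all
  C*-algebra structures on a given type. The library's \<open>norm\<close> is tied to real normed spaces.
\<close>

class cstar_algebra = complex_vector + ring + star +
  fixes cstar_norm :: "'a \<Rightarrow> real"
  assumes scaleC_mult_left: "(a *\<^sub>C x) * y = a *\<^sub>C (x * y)"
    and scaleC_mult_right: "x * (a *\<^sub>C y) = a *\<^sub>C (x * y)"
    and star_star: "(x\<^sup>\<star>)\<^sup>\<star> = x"
    and star_add: "(x + y)\<^sup>\<star> = x\<^sup>\<star> + y\<^sup>\<star>"
    and star_mult: "(x * y)\<^sup>\<star> = y\<^sup>\<star> * x\<^sup>\<star>"
    and star_scaleC: "(a *\<^sub>C x)\<^sup>\<star> = cnj a *\<^sub>C x\<^sup>\<star>"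
    and cstar_norm_eq_0: "cstar_norm x = 0 \<longleftrightarrow> x = 0"
    and cstar_norm_add_le: "cstar_norm (x + y) \<le> cstar_norm x + cstar_norm y"
    and cstar_norm_scaleC: "cstar_norm (a *\<^sub>C x) = cmod a * cstar_norm x"
    and cstar_norm_mult_le: "cstar_norm (x * y) \<le> cstar_norm x * cstar_norm y"
    and cstar_norm_star_mult: "cstar_norm (x\<^sup>\<star> * x) = cstar_norm x ^ 2"
    and cstar_norm_complete:
      "(\<And>e. e > 0 \<Longrightarrow> \<exists>N::nat. \<forall>i\<ge>N. \<forall>j\<ge>N. cstar_norm (X i - X j) < e) \<Longrightarrow>
        \<exists>l. \<forall>e>0. \<exists>N. \<forall>i\<ge>N. cstar_norm (X i - l) < e"

class unital_cstar_algebra = cstar_algebra + ring_1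

abbreviation clinear :: "('a::complex_vector \<Rightarrow> 'b::complex_vector) \<Rightarrow> bool" where
  "clinear \<equiv> Vector_Spaces.linear scaleC scaleC"

abbreviation cspan :: "'a::complex_vector set \<Rightarrow> 'a set" where
  "cspan \<equiv> module.span scaleC"

text \<open>
  A C*-algebra structure on a type, bundled as a record, so that one can quantify over such
  structures.
\<close>

record 'd cstar_struct =
  cadd :: "'d \<Rightarrow> 'd \<Rightarrow> 'd"
  czero :: 'd
  cminus :: "'d \<Rightarrow> 'd \<Rightarrow> 'd"
  cuminus :: "'d \<Rightarrow> 'd"
  cmult :: "'d \<Rightarrow> 'd \<Rightarrow> 'd"
  cscale :: "complex \<Rightarrow> 'd \<Rightarrow> 'd"
  cstar :: "'d \<Rightarrow> 'd"
  cnorm :: "'d \<Rightarrow> real"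

definition is_cstar_algebra :: "'d cstar_struct \<Rightarrow> bool" where
  "is_cstar_algebra D \<longleftrightarrow>
     class.cstar_algebra (cscale D) (cadd D) (czero D) (cminus D) (cuminus D)
       (cstar D) (cmult D) (cnorm D)"

definition class_struct :: "'c::cstar_algebra cstar_struct" where
  "class_struct = \<lparr> cadd = (+), czero = 0, cminus = (-), cuminus = uminus, cmult = (*),
     cscale = scaleC, cstar = star, cnorm = cstar_norm \<rparr>"

lemma is_cstar_algebra_class_struct: "is_cstar_algebra class_struct"
  unfolding is_cstar_algebra_def class_struct_def
  by (simp add: cstar_algebra_class.cstar_algebra_axioms)

definition star_hom :: "'d cstar_struct \<Rightarrow> 'e cstar_struct \<Rightarrow> ('d \<Rightarrow> 'e) \<Rightarrow> bool" where
  "star_hom D E \<rho> \<longleftrightarrow>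
     (\<forall>x y. \<rho> (cadd D x y) = cadd E (\<rho> x) (\<rho> y)) \<and>
     (\<forall>x y. \<rho> (cmult D x y) = cmult E (\<rho> x) (\<rho> y)) \<and>
     (\<forall>a x. \<rho> (cscale D a x) = cscale E a (\<rho> x)) \<and>
     (\<forall>x. \<rho> (cstar D x) = cstar E (\<rho> x))"

section \<open>The algebraic tensor product\<close>

text \<open>
  A multiset of pairs stands for the formal sum of the corresponding elementary tensors; scalars
  are absorbed into either factor. The tensor product is the quotient by the least congruence
  containing the bilinearity relations. The first relation is not implied by the others, because
  multisets only form a monoid.
\<close>

inductive tensor_eq :: "('a::complex_vector \<times> 'b::complex_vector) multiset \<Rightarrow> ('a \<times> 'b) multiset \<Rightarrow> bool"
where
  zero: "tensor_eq {#(0, y)#} {#}"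
| add_left: "tensor_eq {#(x + x', y)#} {#(x, y), (x', y)#}"
| add_right: "tensor_eq {#(x, y + y')#} {#(x, y), (x, y')#}"
| scale: "tensor_eq {#(a *\<^sub>C x, y)#} {#(x, a *\<^sub>C y)#}"
| refl: "tensor_eq M M"
| sym: "tensor_eq M N \<Longrightarrow> tensor_eq N M"
| trans: "tensor_eq M N \<Longrightarrow> tensor_eq N P \<Longrightarrow> tensor_eq M P"
| cong: "tensor_eq M N \<Longrightarrow> tensor_eq (M + P) (N + P)"

quotient_type (overloaded) ('a, 'b) tensor =
    "('a::complex_vector \<times> 'b::complex_vector) multiset" / tensor_eq
  by (intro equivpI reflpI sympI transpI) (blast intro: tensor_eq.intros)+

lemma tensor_eq_add:
  assumes "tensor_eq M N" "tensor_eq P Q"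
  shows "tensor_eq (M + P) (N + Q)"
proof -
  have "tensor_eq (M + P) (N + P)" using assms(1) by (rule tensor_eq.cong)
  moreover have "tensor_eq (P + N) (Q + N)" using assms(2) by (rule tensor_eq.cong)
  ultimately show ?thesis by (metis add.commute tensor_eq.trans)
qed

lemma tensor_eq_scale:
  "tensor_eq M N \<Longrightarrow>
     tensor_eq (image_mset (\<lambda>(x, y). (a *\<^sub>C x, y)) M) (image_mset (\<lambda>(x, y). (a *\<^sub>C x, y)) N)"
proof (induction rule: tensor_eq.induct)
  case (zero y)
  have "a *\<^sub>C (0::'a) = 0"
    by (metis add_cancel_right_right scaleC_add_right)
  then show ?case by (simp add: tensor_eq.zero)
next
  case (scale b x y)
  have "a *\<^sub>C b *\<^sub>C x = b *\<^sub>C a *\<^sub>C x"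
    by (simp add: scaleC_scaleC mult.commute)
  then show ?case using tensor_eq.scale[of b "a *\<^sub>C x" y] by simp
qed (auto simp: scaleC_add_right intro: tensor_eq.intros)

instantiation tensor :: (complex_vector, complex_vector) complex_vector
begin

lift_definition zero_tensor :: "('a, 'b) tensor" is "{#}" .

lift_definition plus_tensor :: "('a, 'b) tensor \<Rightarrow> ('a, 'b) tensor \<Rightarrow> ('a, 'b) tensor" is "(+)"
  by (rule tensor_eq_add)

lift_definition scaleC_tensor :: "complex \<Rightarrow> ('a, 'b) tensor \<Rightarrow> ('a, 'b) tensor"
  is "\<lambda>a. image_mset (\<lambda>(x, y). (a *\<^sub>C x, y))"
  by (rule tensor_eq_scale)

definition uminus_tensor :: "('a, 'b) tensor \<Rightarrow> ('a, 'b) tensor" where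
  "uminus_tensor u = (-1) *\<^sub>C u"

definition minus_tensor :: "('a, 'b) tensor \<Rightarrow> ('a, 'b) tensor \<Rightarrow> ('a, 'b) tensor" where
  "minus_tensor u v = u + - v"

instance
proof
  fix u v w :: "('a, 'b) tensor" and a b :: complex
  show "u + v + w = u + (v + w)" by transfer (simp add: tensor_eq.refl ac_simps)
  show "u + v = v + u" by transfer (simp add: tensor_eq.refl ac_simps)
  show "0 + u = u" by transfer (simp add: tensor_eq.refl)
  show "u - v = u + - v" by (fact minus_tensor_def)
  show "a *\<^sub>C (u + v) = a *\<^sub>C u + a *\<^sub>C v" by transfer (simp add: tensor_eq.refl)
  show "a *\<^sub>C b *\<^sub>C u = (a * b) *\<^sub>C u"
    by transfer
      (simp add: multiset.map_comp comp_def case_prod_unfold scaleC_scaleC tensor_eq.refl)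
  show "1 *\<^sub>C u = u"
    by transfer (simp add: scaleC_one case_prod_unfold tensor_eq.refl)
  show add_left: "(a + b) *\<^sub>C u = a *\<^sub>C u + b *\<^sub>C u" for a b and u :: "('a, 'b) tensor"
  proof (transfer fixing: a b)
    fix M :: "('a \<times> 'b) multiset"
    show "tensor_eq (image_mset (\<lambda>(x, y). ((a + b) *\<^sub>C x, y)) M)
        (image_mset (\<lambda>(x, y). (a *\<^sub>C x, y)) M + image_mset (\<lambda>(x, y). (b *\<^sub>C x, y)) M)"
    proof (induction M)
      case empty
      show ?case by (simp add: tensor_eq.refl)
    next
      case (add p M)
      obtain x y where p: "p = (x, y)" by (cases p)
      show ?case
        using tensor_eq_add[OF tensor_eq.add_left[of "a *\<^sub>C x" "b *\<^sub>C x" y] add.IH]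
        by (simp add: p scaleC_add_left ac_simps add_mset_commute)
    qed
  qed
  have zero: "0 *\<^sub>C x = 0" for x :: 'a
    by (metis add_cancel_right_right scaleC_add_left add.right_neutral)
  have "0 *\<^sub>C u = 0"
  proof transfer
    fix M :: "('a \<times> 'b) multiset"
    show "tensor_eq (image_mset (\<lambda>(x, y). (0 *\<^sub>C x, y)) M) {#}"
    proof (induction M)
      case empty
      show ?case by (simp add: tensor_eq.refl)
    next
      case (add p M)
      obtain x y where p: "p = (x, y)" by (cases p)
      show ?case
        using tensor_eq_add[OF tensor_eq.zero[of y] add.IH] by (simp add: p zero)
    qed
  qed
  moreover have "1 *\<^sub>C u = u"
    by transfer (simp add: scaleC_one case_prod_unfold tensor_eq.refl)
  ultimately show "- u + u = 0"
    unfolding uminus_tensor_def using add_left[of "-1" 1 u] by simp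
qed

end

lift_definition tens :: "'a::complex_vector \<Rightarrow> 'b::complex_vector \<Rightarrow> ('a, 'b) tensor" (infixl \<open>\<otimes>\<close> 70)
  is "\<lambda>x y. {#(x, y)#}" .

text \<open>
  The additive map induced by \<open>x \<otimes> y \<mapsto> F x y\<close>. It does not depend on the chosen
  representative as long as \<^term>\<open>F\<close> is biadditive and balanced over the complex numbers;
  linearity in each variable is not needed, so that sesquilinear forms can be extended
  one argument at a time.
\<close>

definition tlift ::
  "('a::complex_vector \<Rightarrow> 'b::complex_vector \<Rightarrow> 'e::ab_group_add) \<Rightarrow> ('a, 'b) tensor \<Rightarrow> 'e" where
  "tlift F u = (\<Sum>(x, y)\<in>#rep_tensor u. F x y)"

lemma tlift_abs_tensor:
  assumes "\<And>x x' y. F (x + x') y = F x y + F x' y"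
    and "\<And>x y y'. F x (y + y') = F x y + F x y'"
    and "\<And>a x y. F (a *\<^sub>C x) y = F x (a *\<^sub>C y)"
  shows "tlift F (abs_tensor M) = (\<Sum>(x, y)\<in>#M. F x y)"
proof -
  have zero: "F 0 y = 0" for y
    using assms(1)[of 0 0 y] by simp
  have "(\<Sum>(x, y)\<in>#M. F x y) = (\<Sum>(x, y)\<in>#N. F x y)" if "tensor_eq M N" for M N
    using that by induction (simp_all add: assms zero)
  moreover have "tensor_eq (rep_tensor (abs_tensor M)) M"
    by (rule Quotient_rep_abs[OF Quotient_tensor]) (rule tensor_eq.refl)
  ultimately show ?thesis by (simp add: tlift_def)
qed

definition tmap ::
  "('a::complex_vector \<Rightarrow> 'e::complex_vector) \<Rightarrow> ('b::complex_vector \<Rightarrow> 'f::complex_vector) \<Rightarrow>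
     ('a, 'b) tensor \<Rightarrow> ('e, 'f) tensor" where
  "tmap f g = tlift (\<lambda>x y. f x \<otimes> g y)"

section \<open>Finite quantum graphs\<close>

definition state :: "('b::unital_cstar_algebra \<Rightarrow> complex) \<Rightarrow> bool" where
  "state \<psi> \<longleftrightarrow>
     (\<forall>x y. \<psi> (x + y) = \<psi> x + \<psi> y) \<and> (\<forall>a x. \<psi> (a *\<^sub>C x) = a * \<psi> x) \<and>
     (\<forall>x. \<psi> (x\<^sup>\<star> * x) \<in> \<real>\<^sub>\<ge>\<^sub>0) \<and> \<psi> 1 = 1"

text \<open>Faithfulness says that \<^term>\<open>\<psi> (x\<^sup>\<star> * y)\<close> is an inner product on the whole algebra.\<close>

definition faithful_state :: "('b::unital_cstar_algebra \<Rightarrow> complex) \<Rightarrow> bool" where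
  "faithful_state \<psi> \<longleftrightarrow> state \<psi> \<and> (\<forall>x. \<psi> (x\<^sup>\<star> * x) = 0 \<longrightarrow> x = 0)"

text \<open>Inner products are conjugate-linear in the first argument.\<close>

definition L2_inner :: "('b::cstar_algebra \<Rightarrow> complex) \<Rightarrow> 'b \<Rightarrow> 'b \<Rightarrow> complex" where
  "L2_inner \<psi> x y = \<psi> (x\<^sup>\<star> * y)"

definition L2_tensor_inner ::
  "('b::cstar_algebra \<Rightarrow> complex) \<Rightarrow> ('b, 'b) tensor \<Rightarrow> ('b, 'b) tensor \<Rightarrow> complex" where
  "L2_tensor_inner \<psi> u v =
     tlift (\<lambda>x y. tlift (\<lambda>z w. L2_inner \<psi> x z * L2_inner \<psi> y w) v) u"

definition mult_map :: "('b::cstar_algebra, 'b) tensor \<Rightarrow> 'b" where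
  "mult_map = tlift (*)"

definition mult_adj :: "('b::cstar_algebra \<Rightarrow> complex) \<Rightarrow> 'b \<Rightarrow> ('b, 'b) tensor" where
  "mult_adj \<psi> x = (THE u. \<forall>v. L2_tensor_inner \<psi> v u = L2_inner \<psi> (mult_map v) x)"

definition delta_form :: "real \<Rightarrow> ('b::unital_cstar_algebra \<Rightarrow> complex) \<Rightarrow> bool" where
  "delta_form \<delta> \<psi> \<longleftrightarrow> \<delta> > 0 \<and> faithful_state \<psi> \<and>
     (\<forall>x. mult_map (mult_adj \<psi> x) = complex_of_real (\<delta>\<^sup>2) *\<^sub>C x)"

definition schur_idempotent ::
  "real \<Rightarrow> ('b::cstar_algebra \<Rightarrow> complex) \<Rightarrow> ('b \<Rightarrow> 'b) \<Rightarrow> bool" where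
  "schur_idempotent \<delta> \<psi> A \<longleftrightarrow> clinear A \<and>
     (\<forall>x. mult_map (tmap A A (mult_adj \<psi> x)) = complex_of_real (\<delta>\<^sup>2) *\<^sub>C A x)"

text \<open>Positivity in the algebra of \<open>n\<close> by \<open>n\<close> matrices, i.e. \<open>P = Q\<^sup>\<star> Q\<close>; only the entries
  with indices below \<open>n\<close> matter.\<close>

definition matrix_positive :: "nat \<Rightarrow> (nat \<Rightarrow> nat \<Rightarrow> 'b::cstar_algebra) \<Rightarrow> bool" where
  "matrix_positive n P \<longleftrightarrow> (\<exists>Q. \<forall>i<n. \<forall>j<n. P i j = (\<Sum>k<n. (Q k i)\<^sup>\<star> * Q k j))"

definition completely_positive :: "('b::cstar_algebra \<Rightarrow> 'b) \<Rightarrow> bool" where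
  "completely_positive A \<longleftrightarrow> clinear A \<and>
     (\<forall>n P. matrix_positive n P \<longrightarrow> matrix_positive n (\<lambda>i j. A (P i j)))"

definition finite_quantum_graph ::
  "real \<Rightarrow> ('b::unital_cstar_algebra \<Rightarrow> complex) \<Rightarrow> ('b \<Rightarrow> 'b) \<Rightarrow> bool" where
  "finite_quantum_graph \<delta> \<psi> A \<longleftrightarrow>
     (\<exists>S::'b set. finite S \<and> cspan S = UNIV) \<and> delta_form \<delta> \<psi> \<and> schur_idempotent \<delta> \<psi> A"

definition central_projection :: "'b::cstar_algebra \<Rightarrow> bool" where
  "central_projection p \<longleftrightarrow> p * p = p \<and> p\<^sup>\<star> = p \<and> (\<forall>x. p * x = x * p)"

section \<open>C*-correspondences and the quantum edge correspondence\<close>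

record ('b, 'x) correspondence =
  vecs :: "'x set"
  lact :: "'b \<Rightarrow> 'x \<Rightarrow> 'x"
  ract :: "'x \<Rightarrow> 'b \<Rightarrow> 'x"
  inner :: "'x \<Rightarrow> 'x \<Rightarrow> 'b"

definition tensor_correspondence ::
  "('b::unital_cstar_algebra \<Rightarrow> complex) \<Rightarrow> ('b, ('b, 'b) tensor) correspondence" where
  "tensor_correspondence \<psi> = \<lparr>
     vecs = UNIV,
     lact = (\<lambda>a. tmap (\<lambda>x. a * x) id),
     ract = (\<lambda>u b. tmap id (\<lambda>y. y * b) u),
     inner = (\<lambda>u v. tlift (\<lambda>x y. tlift (\<lambda>z w. \<psi> (x\<^sup>\<star> * z) *\<^sub>C (y\<^sup>\<star> * w)) v) u) \<rparr>"

definition edge_vector ::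
  "real \<Rightarrow> ('b::unital_cstar_algebra \<Rightarrow> complex) \<Rightarrow> ('b \<Rightarrow> 'b) \<Rightarrow> ('b, 'b) tensor" where
  "edge_vector \<delta> \<psi> A = complex_of_real (1 / \<delta>\<^sup>2) *\<^sub>C tmap id A (mult_adj \<psi> 1)"

definition edge_correspondence ::
  "real \<Rightarrow> ('b::unital_cstar_algebra \<Rightarrow> complex) \<Rightarrow> ('b \<Rightarrow> 'b) \<Rightarrow>
     ('b, ('b, 'b) tensor) correspondence" where
  "edge_correspondence \<delta> \<psi> A = (let T = tensor_correspondence \<psi> in
     T\<lparr> vecs := cspan {lact T x (ract T (edge_vector \<delta> \<psi> A) y) | x y. True} \<rparr>)"

section \<open>Internal tensor powers\<close>

text \<open>
  The inner product of the elementary tensors of two lists of equal length \<open>k \<ge> 1\<close>, computed from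
  \<open>\<langle>\<xi> \<otimes> x | \<eta> \<otimes> y\<rangle> = \<langle>x | \<langle>\<xi> | \<eta>\<rangle> \<cdot> y\<rangle>\<close>; the accumulator starts as
  the unit, i.e. as the inner product of the unit with itself in the zeroth power.
\<close>

fun list_inner :: "('b::times, 'x) correspondence \<Rightarrow> 'b \<Rightarrow> 'x list \<Rightarrow> 'x list \<Rightarrow> 'b" where
  "list_inner X b (x # xs) (y # ys) = list_inner X (inner X x (lact X b y)) xs ys"
| "list_inner X b _ _ = b"

definition formal_inner ::
  "('b::unital_cstar_algebra, 'x) correspondence \<Rightarrow> 'x list multiset \<Rightarrow> 'x list multiset \<Rightarrow> 'b" where
  "formal_inner X M N = (\<Sum>xs\<in>#M. \<Sum>ys\<in>#N. list_inner X 1 xs ys)"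

text \<open>
  Formal sums of elementary tensors of length \<open>k\<close>. Two formal sums are identified if their
  difference is a null vector of the semi-inner product. For finite-dimensional \<open>X\<close> the quotient
  is already complete, hence it is the internal tensor power.
\<close>

definition formal_tensors :: "('b, 'x) correspondence \<Rightarrow> nat \<Rightarrow> 'x list multiset set" where
  "formal_tensors X k = {M. \<forall>xs\<in>#M. length xs = k \<and> set xs \<subseteq> vecs X}"

definition tensor_class ::
  "('b::unital_cstar_algebra, 'x) correspondence \<Rightarrow> nat \<Rightarrow> 'x list multiset \<Rightarrow> 'x list multiset set"
where
  "tensor_class X k M = {N \<in> formal_tensors X k.
     formal_inner X M M - formal_inner X M N - formal_inner X N M + formal_inner X N N = 0}"

definition tensor_power ::
  "('b::unital_cstar_algebra, 'x) correspondence \<Rightarrow> nat \<Rightarrow> 'x list multiset set set" where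
  "tensor_power X k = tensor_class X k ` formal_tensors X k"

definition elementary ::
  "('b::unital_cstar_algebra, 'x) correspondence \<Rightarrow> 'x list \<Rightarrow> 'x list multiset set" where
  "elementary X xs = tensor_class X (length xs) {#xs#}"

section \<open>The Cuntz--Pimsner algebra\<close>

definition toeplitz_representation ::
  "('b::unital_cstar_algebra, 'x::complex_vector) correspondence \<Rightarrow> 'd cstar_struct \<Rightarrow>
     ('b \<Rightarrow> 'd) \<Rightarrow> ('x \<Rightarrow> 'd) \<Rightarrow> bool" where
  "toeplitz_representation X D \<pi> t \<longleftrightarrow>
     star_hom class_struct D \<pi> \<and>
     (\<forall>\<xi>\<in>vecs X. \<forall>\<eta>\<in>vecs X. t (\<xi> + \<eta>) = cadd D (t \<xi>) (t \<eta>)) \<and>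
     (\<forall>\<xi>\<in>vecs X. \<forall>a. t (a *\<^sub>C \<xi>) = cscale D a (t \<xi>)) \<and>
     (\<forall>\<xi>\<in>vecs X. \<forall>b. t (lact X b \<xi>) = cmult D (\<pi> b) (t \<xi>)) \<and>
     (\<forall>\<xi>\<in>vecs X. \<forall>b. t (ract X \<xi> b) = cmult D (t \<xi>) (\<pi> b)) \<and>
     (\<forall>\<xi>\<in>vecs X. \<forall>\<eta>\<in>vecs X. cmult D (cstar D (t \<xi>)) (t \<eta>) = \<pi> (inner X \<xi> \<eta>))"

text \<open>
  The left action of \<open>a\<close> is the finite sum of the rank-one operators
  \<open>\<theta>\<^bsub>\<xi>,\<eta>\<^esub>(\<zeta>) = \<xi> \<cdot> \<langle>\<eta> | \<zeta>\<rangle>\<close> given by a list of pairs. For finite-dimensional \<open>X\<close>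
  all compact operators are of this form.
\<close>

definition acts_as_finite_rank ::
  "('b, 'x::complex_vector) correspondence \<Rightarrow> 'b \<Rightarrow> ('x \<times> 'x) list \<Rightarrow> bool" where
  "acts_as_finite_rank X a ps \<longleftrightarrow> set ps \<subseteq> vecs X \<times> vecs X \<and>
     (\<forall>\<zeta>\<in>vecs X. lact X a \<zeta> = (\<Sum>(\<xi>, \<eta>)\<leftarrow>ps. ract X \<xi> (inner X \<eta> \<zeta>)))"

text \<open>Elements acting by compact operators and annihilating the kernel of the left action.\<close>

definition katsura_ideal ::
  "('b::unital_cstar_algebra, 'x::complex_vector) correspondence \<Rightarrow> 'b set" where
  "katsura_ideal X = {a. (\<exists>ps. acts_as_finite_rank X a ps) \<and>
     (\<forall>b. (\<forall>\<zeta>\<in>vecs X. lact X b \<zeta> = 0) \<longrightarrow> a * b = 0)}"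

definition covariant_representation ::
  "('b::unital_cstar_algebra, 'x::complex_vector) correspondence \<Rightarrow> 'd cstar_struct \<Rightarrow>
     ('b \<Rightarrow> 'd) \<Rightarrow> ('x \<Rightarrow> 'd) \<Rightarrow> bool" where
  "covariant_representation X D \<pi> t \<longleftrightarrow> toeplitz_representation X D \<pi> t \<and>
     (\<forall>a\<in>katsura_ideal X. \<forall>ps. acts_as_finite_rank X a ps \<longrightarrow>
        \<pi> a = foldr (\<lambda>(\<xi>, \<eta>). cadd D (cmult D (t \<xi>) (cstar D (t \<eta>)))) ps (czero D))"

text \<open>
  The type \<open>'c\<close> with the maps \<open>\<pi>\<close> and \<open>t\<close> is the Cuntz--Pimsner algebra of \<open>X\<close>. HOL cannot
  quantify over types, so the test algebras \<open>D\<close> range over all C*-algebra structures on the type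
  \<open>'c\<close>. For finite-dimensional \<open>X\<close> this is no restriction if \<open>'c\<close> has more than one element: any
  covariant representation lives in a separable C*-algebra, whose cardinality is at most that of
  the continuum and hence of \<open>'c\<close>, and its direct sum with \<open>'c\<close> can be transported to \<open>'c\<close>.
  The algebra is generated by the images of \<open>\<pi>\<close> and \<open>t\<close> because of the uniqueness of \<open>\<rho>\<close>.
\<close>

definition universal_covariant_representation ::
  "('b::unital_cstar_algebra, 'x::complex_vector) correspondence \<Rightarrow>
     ('b \<Rightarrow> 'c::cstar_algebra) \<Rightarrow> ('x \<Rightarrow> 'c) \<Rightarrow> bool" where
  "universal_covariant_representation X \<pi> t \<longleftrightarrow>
     covariant_representation X class_struct \<pi> t \<and>
     (\<forall>(D::'c cstar_struct) \<pi>' t'.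
        is_cstar_algebra D \<and> covariant_representation X D \<pi>' t' \<longrightarrow>
        (\<exists>!\<rho>. star_hom class_struct D \<rho> \<and> (\<forall>b. \<rho> (\<pi> b) = \<pi>' b) \<and>
           (\<forall>\<xi>\<in>vecs X. \<rho> (t \<xi>) = t' \<xi>)))"

section \<open>Non-returning vectors\<close>

text \<open>Products of nonempty lists; the algebra \<open>'c\<close> need not carry a unit.\<close>

fun list_product :: "'c::times list \<Rightarrow> 'c" where
  "list_product [x] = x"
| "list_product (x # y # xs) = x * list_product (y # xs)"

text \<open>The value on a class \<open>\<xi>\<close> is the common value on all formal sums representing it.\<close>

definition power_map :: "('x \<Rightarrow> 'c::cstar_algebra) \<Rightarrow> 'x list multiset set \<Rightarrow> 'c" where
  "power_map t \<xi> = the_elem ((\<lambda>M. \<Sum>xs\<in>#M. list_product (map t xs)) ` \<xi>)"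

definition non_returning ::
  "('b::unital_cstar_algebra, 'x::complex_vector) correspondence \<Rightarrow> ('x \<Rightarrow> 'c::cstar_algebra) \<Rightarrow>
     nat \<Rightarrow> 'x list multiset set \<Rightarrow> bool" where
  "non_returning X t m \<xi> \<longleftrightarrow> \<xi> \<in> tensor_power X m \<and>
     (\<forall>n \<eta>. 0 < n \<and> n < m \<and> \<eta> \<in> tensor_power X n \<longrightarrow>
        (power_map t \<xi>)\<^sup>\<star> * power_map t \<eta> * power_map t \<xi> = 0)"

end

theory Submission
  imports Defs
begin

text \<open>
  Right multiplication by \<open>p\<close> annihilates the edge correspondence: the second legs of \<open>\<epsilon>\<close> lie in
  the range of \<open>A\<close>, on which the central projection \<open>p\<close> vanishes, so \<open>\<epsilon> \<cdot> p = 0\<close>, and centrality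
  gives \<open>(x \<cdot> \<epsilon> \<cdot> y) \<cdot> p = x \<cdot> (\<epsilon> \<cdot> p) \<cdot> y = 0\<close>. For a classical graph, \<open>p\<close> is a set of sources, and
  no edge can be followed by one that starts in \<open>p\<close>. In a Toeplitz representation the product
  \<open>t\<^sup>n(\<eta>) t\<^sup>m(\<xi>)\<close> for \<open>\<xi> = (p \<cdot> \<epsilon>) \<otimes> \<epsilon> \<otimes> \<dots> \<otimes> \<epsilon>\<close> contains the factor
  \<open>t(\<eta>\<^sub>n) t(p \<cdot> \<epsilon>) = t(\<eta>\<^sub>n \<cdot> p) t(\<epsilon>) = 0\<close>, which proves the claim for elementary
  tensors \<open>\<eta>\<close>, hence for all \<open>\<eta>\<close> (lemmas \<open>ract_edge_correspondence_eq_0\<close> and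
  \<open>list_product_append_eq_0\<close>).

  It remains to see that the value of \<open>t\<^sup>k\<close> on a class of formal sums is computed by any of
  its representatives. The Toeplitz relation turns the inner product of formal sums into
  \<open>t\<^sup>k(M)\<^sup>\<star> t\<^sup>k(N)\<close>, so a difference of length zero is sent to an element \<open>d\<close> with
  \<open>d\<^sup>\<star> d = 0\<close>, and the C*-identity forces \<open>d = 0\<close> (lemma \<open>power_map_tensor_class\<close>).
\<close>

section \<open>Complex vector spaces and C*-algebras\<close>

interpretation cvec: vector_space "scaleC :: complex \<Rightarrow> 'a \<Rightarrow> 'a::complex_vector"
  by unfold_locales (simp_all add: scaleC_add_right scaleC_add_left scaleC_scaleC scaleC_one)

lemma clinear_iff:
  "clinear f \<longleftrightarrow> (\<forall>x y. f (x + y) = f x + f y) \<and> (\<forall>a x. f (a *\<^sub>C x) = a *\<^sub>C f x)"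
  by (auto simp: Vector_Spaces.linear_iff cvec.vector_space_axioms)

lemma clinear_id: "clinear id" "clinear (\<lambda>x. x)"
  by (simp_all add: clinear_iff)

lemma clinear_mult_left: "clinear (\<lambda>x::'a::cstar_algebra. a * x)"
  by (simp add: clinear_iff distrib_left scaleC_mult_right)

lemma clinear_mult_right: "clinear (\<lambda>x::'a::cstar_algebra. x * a)"
  by (simp add: clinear_iff distrib_right scaleC_mult_left)

lemma star_zero: "(0::'a::cstar_algebra)\<^sup>\<star> = 0"
  using star_add[of "0::'a" 0] by simp

lemma star_diff: "((x::'a::cstar_algebra) - y)\<^sup>\<star> = x\<^sup>\<star> - y\<^sup>\<star>"
  using star_add[of "x - y" y] by simp

lemma star_sum_mset: "(\<Sum>x\<in>#M. f x)\<^sup>\<star> = (\<Sum>x\<in>#M. (f x :: 'a::cstar_algebra)\<^sup>\<star>)"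
  by (induction M) (simp_all add: star_zero star_add)

lemma star_mult_self_eq_0:
  assumes "(x::'a::cstar_algebra)\<^sup>\<star> * x = 0"
  shows "x = 0"
proof -
  have "cstar_norm x ^ 2 = cstar_norm (0::'a)"
    using cstar_norm_star_mult[of x] by (simp only: assms)
  also have "\<dots> = 0"
    using cstar_norm_eq_0[of "0::'a"] by blast
  finally have "cstar_norm x = 0"
    by (rule power_eq_0_iff[THEN iffD1, THEN conjunct1])
  then show ?thesis
    by (rule cstar_norm_eq_0[THEN iffD1])
qed

section \<open>Maps on algebraic tensor products\<close>

lemma tens_add_left: "(x + x') \<otimes> y = x \<otimes> y + x' \<otimes> y"
  by transfer (use tensor_eq.add_left in \<open>simp add: add_mset_commute\<close>)

lemma tens_add_right: "x \<otimes> (y + y') = x \<otimes> y + x \<otimes> y'"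
  by transfer (use tensor_eq.add_right in \<open>simp add: add_mset_commute\<close>)

lemma tens_scale_left: "(a *\<^sub>C x) \<otimes> y = a *\<^sub>C (x \<otimes> y)"
  by transfer (simp add: tensor_eq.refl)

lemma tens_scale_right: "x \<otimes> (a *\<^sub>C y) = a *\<^sub>C (x \<otimes> y)"
  by transfer (simp add: tensor_eq.scale tensor_eq.sym)

lemma tens_zero_right: "x \<otimes> 0 = 0"
  using tens_add_right[of x 0 0] by simp

lemma tensor_induct [case_names zero tens add]:
  assumes "P 0" "\<And>x y. P (x \<otimes> y)" "\<And>u v. P u \<Longrightarrow> P v \<Longrightarrow> P (u + v)"
  shows "P u"
proof (induction u rule: tensor.abs_induct)
  case (1 M)
  show ?case
  proof (induction M)
    case empty
    show ?case using assms(1) by (simp add: zero_tensor_def)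
  next
    case (add q M)
    obtain x y where "q = (x, y)" by (cases q)
    then have "abs_tensor (add_mset q M) = x \<otimes> y + abs_tensor M"
      by (simp add: tens.abs_eq plus_tensor.abs_eq)
    then show ?case using assms(2,3) add.IH by simp
  qed
qed

lemma
  assumes "clinear f" "clinear g"
  shows tmap_tens: "tmap f g (x \<otimes> y) = f x \<otimes> g y"
    and tmap_add: "tmap f g (u + v) = tmap f g u + tmap f g v"
    and tmap_zero: "tmap f g 0 = 0"
proof -
  have abs: "tmap f g (abs_tensor M) = (\<Sum>(x, y)\<in>#M. f x \<otimes> g y)" for M
    using assms unfolding tmap_def clinear_iff
    by (intro tlift_abs_tensor)
      (simp_all add: tens_add_left tens_add_right tens_scale_left tens_scale_right)
  show "tmap f g (x \<otimes> y) = f x \<otimes> g y"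
    by (simp add: abs tens.abs_eq)
  show "tmap f g (u + v) = tmap f g u + tmap f g v"
    by (induction u rule: tensor.abs_induct, induction v rule: tensor.abs_induct)
      (simp add: abs plus_tensor.abs_eq)
  show "tmap f g 0 = 0"
    by (simp add: abs zero_tensor_def)
qed

lemma tmap_scale:
  assumes "clinear f" "clinear g"
  shows "tmap f g (a *\<^sub>C u) = a *\<^sub>C tmap f g u"
proof (induction u rule: tensor_induct)
  case zero
  show ?case using assms by (simp add: tmap_zero)
next
  case (tens x y)
  have "tmap f g ((a *\<^sub>C x) \<otimes> y) = f (a *\<^sub>C x) \<otimes> g y"
    using assms by (rule tmap_tens)
  then show ?case
    using assms(1) by (simp add: tmap_tens[OF assms] tens_scale_left clinear_iff)
next
  case (add u v)
  then show ?case using assms by (simp add: tmap_add scaleC_add_right)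
qed

lemma clinear_tmap: "clinear f \<Longrightarrow> clinear g \<Longrightarrow> clinear (tmap f g)"
  by (subst clinear_iff) (simp add: tmap_add tmap_scale)

lemma tmap_tmap:
  assumes "clinear f" "clinear g" "clinear h" "clinear k"
  shows "tmap f g (tmap h k u) = tmap (\<lambda>x. f (h x)) (\<lambda>y. g (k y)) u"
proof -
  have "clinear (\<lambda>x. f (h x))" "clinear (\<lambda>y. g (k y))"
    using assms by (simp_all add: clinear_iff)
  then show ?thesis
    using assms by (induction u rule: tensor_induct) (simp_all add: tmap_tens tmap_add tmap_zero)
qed

lemma tmap_id: "tmap id id u = u"
  by (induction u rule: tensor_induct)
    (simp_all only: tmap_tens tmap_add tmap_zero clinear_id id_apply)

lemma tmap_zero_right:
  assumes "clinear f"
  shows "tmap f (\<lambda>y. 0) u = 0"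
proof -
  have "clinear (\<lambda>y. 0)" by (simp add: clinear_iff)
  note lin = assms this
  show ?thesis
    by (induction u rule: tensor_induct)
      (simp_all add: tmap_tens[OF lin] tmap_add[OF lin] tmap_zero[OF lin] tens_zero_right)
qed

section \<open>The edge correspondence as a bimodule\<close>

lemma lact_tensor_correspondence: "lact (tensor_correspondence \<psi>) a u = tmap (\<lambda>x. a * x) id u"
  and ract_tensor_correspondence: "ract (tensor_correspondence \<psi>) u b = tmap id (\<lambda>y. y * b) u"
  by (simp_all add: tensor_correspondence_def)

lemma clinear_lact: "clinear (lact (tensor_correspondence \<psi>) a)"
  unfolding tensor_correspondence_def
  by (simp add: clinear_tmap clinear_mult_left clinear_id)

lemma clinear_ract: "clinear (\<lambda>u. ract (tensor_correspondence \<psi>) u b)"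
  unfolding tensor_correspondence_def
  by (simp add: clinear_tmap clinear_mult_right clinear_id)

lemma lact_one: "lact (tensor_correspondence \<psi>) 1 u = u"
  and ract_one: "ract (tensor_correspondence \<psi>) u 1 = u"
  using tmap_id[of u]
  by (simp_all add: lact_tensor_correspondence ract_tensor_correspondence id_def[symmetric])

lemma lact_lact:
  "lact (tensor_correspondence \<psi>) a (lact (tensor_correspondence \<psi>) b u) =
     lact (tensor_correspondence \<psi>) (a * b) u"
  by (simp add: lact_tensor_correspondence tmap_tmap clinear_mult_left clinear_id id_def mult.assoc)

lemma ract_ract:
  "ract (tensor_correspondence \<psi>) (ract (tensor_correspondence \<psi>) u a) b =
     ract (tensor_correspondence \<psi>) u (a * b)"
  by (simp add: ract_tensor_correspondence tmap_tmap clinear_mult_right clinear_id id_def mult.assoc)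

lemma ract_lact:
  "ract (tensor_correspondence \<psi>) (lact (tensor_correspondence \<psi>) a u) b =
     lact (tensor_correspondence \<psi>) a (ract (tensor_correspondence \<psi>) u b)"
  by (simp add: lact_tensor_correspondence ract_tensor_correspondence tmap_tmap
      clinear_mult_left clinear_mult_right clinear_id id_def)

lemma vecs_edge_correspondence:
  "vecs (edge_correspondence \<delta> \<psi> A) =
     cspan {lact (tensor_correspondence \<psi>) x (ract (tensor_correspondence \<psi>) (edge_vector \<delta> \<psi> A) y)
       | x y. True}"
  by (simp add: edge_correspondence_def Let_def)

lemma
  shows lact_edge_correspondence: "lact (edge_correspondence \<delta> \<psi> A) = lact (tensor_correspondence \<psi>)"
    and ract_edge_correspondence: "ract (edge_correspondence \<delta> \<psi> A) = ract (tensor_correspondence \<psi>)"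
  by (simp_all add: edge_correspondence_def Let_def)

lemma edge_vector_in_edge_correspondence:
  "edge_vector \<delta> \<psi> A \<in> vecs (edge_correspondence \<delta> \<psi> A)"
  unfolding vecs_edge_correspondence
proof (rule cvec.span_base, intro CollectI exI conjI)
  show "edge_vector \<delta> \<psi> A = lact (tensor_correspondence \<psi>) 1
      (ract (tensor_correspondence \<psi>) (edge_vector \<delta> \<psi> A) 1)"
    by (simp add: lact_one ract_one)
qed simp

lemma lact_in_edge_correspondence:
  assumes "\<zeta> \<in> vecs (edge_correspondence \<delta> \<psi> A)"
  shows "lact (edge_correspondence \<delta> \<psi> A) a \<zeta> \<in> vecs (edge_correspondence \<delta> \<psi> A)"
  using assms unfolding vecs_edge_correspondence lact_edge_correspondence
proof (induction rule: cvec.span_induct_alt)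
  case base
  have "lact (tensor_correspondence \<psi>) a 0 = 0"
    by (simp add: lact_tensor_correspondence tmap_zero clinear_mult_left clinear_id)
  then show ?case by (simp add: cvec.span_zero)
next
  case (step c u v)
  then have "lact (tensor_correspondence \<psi>) a u \<in>
      cspan {lact (tensor_correspondence \<psi>) x
        (ract (tensor_correspondence \<psi>) (edge_vector \<delta> \<psi> A) y) | x y. True}"
    by (force simp: lact_lact intro!: cvec.span_base)
  with step clinear_lact[of \<psi> a] show ?case
    by (simp add: clinear_iff cvec.span_add cvec.span_scale)
qed

text \<open>
  The second leg of the edge vector lies in the range of \<open>A\<close>, so it is killed by \<open>p\<close> from
  the right. As \<open>p\<close> commutes with the right coefficients, this passes to the whole bimodule.
\<close>

lemma ract_edge_correspondence_eq_0:
  assumes "clinear A" "central_projection p" "\<And>x. p * A x = 0"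
    and "\<zeta> \<in> vecs (edge_correspondence \<delta> \<psi> A)"
  shows "ract (edge_correspondence \<delta> \<psi> A) \<zeta> p = 0"
  using assms(4) unfolding vecs_edge_correspondence ract_edge_correspondence
proof (induction rule: cvec.span_induct_alt)
  case base
  show ?case by (simp add: ract_tensor_correspondence tmap_zero clinear_mult_right clinear_id)
next
  case (step c u v)
  let ?T = "tensor_correspondence \<psi>" and ?\<epsilon> = "edge_vector \<delta> \<psi> A"
  obtain x y where u: "u = lact ?T x (ract ?T ?\<epsilon> y)" using step(1) by auto
  have comm: "z * p = p * z" for z
    using assms(2) by (simp add: central_projection_def)
  have "ract ?T ?\<epsilon> p = 0"
    using assms(1) by (simp add: edge_vector_def ract_tensor_correspondence tmap_scale tmap_tmap
        clinear_mult_left clinear_id comm assms(3) tmap_zero_right)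
  then have "ract ?T u p = lact ?T x (ract ?T 0 y)"
    using ract_ract[of \<psi> ?\<epsilon> p y] by (simp add: u ract_lact ract_ract comm)
  also have "\<dots> = 0"
    by (simp add: lact_tensor_correspondence ract_tensor_correspondence tmap_zero
        clinear_mult_left clinear_mult_right clinear_id)
  finally show ?case
    using step(2) clinear_ract[of \<psi> p] by (simp add: clinear_iff)
qed

section \<open>Toeplitz representations on tensor powers\<close>

lemma list_product_Cons: "xs \<noteq> [] \<Longrightarrow> list_product (x # xs) = x * list_product xs"
  by (cases xs) simp_all

locale unital_toeplitz_representation =
  fixes X :: "('b::unital_cstar_algebra, 'x::complex_vector) correspondence"
    and \<pi> :: "'b \<Rightarrow> 'c::cstar_algebra" and t :: "'x \<Rightarrow> 'c"
  assumes toeplitz: "toeplitz_representation X class_struct \<pi> t"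
    and lact_closed: "\<zeta> \<in> vecs X \<Longrightarrow> lact X b \<zeta> \<in> vecs X"
    and lact_1: "\<zeta> \<in> vecs X \<Longrightarrow> lact X 1 \<zeta> = \<zeta>"
begin

lemma rep_add: "\<pi> (a + b) = \<pi> a + \<pi> b"
  and t_scale: "\<zeta> \<in> vecs X \<Longrightarrow> t (c *\<^sub>C \<zeta>) = c *\<^sub>C t \<zeta>"
  and t_lact: "\<zeta> \<in> vecs X \<Longrightarrow> t (lact X b \<zeta>) = \<pi> b * t \<zeta>"
  and t_ract: "\<zeta> \<in> vecs X \<Longrightarrow> t (ract X \<zeta> b) = t \<zeta> * \<pi> b"
  and star_t_mult_t: "\<zeta> \<in> vecs X \<Longrightarrow> \<eta> \<in> vecs X \<Longrightarrow> (t \<zeta>)\<^sup>\<star> * t \<eta> = \<pi> (inner X \<zeta> \<eta>)"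
  using toeplitz by (simp_all add: toeplitz_representation_def star_hom_def class_struct_def)

lemma rep_zero: "\<pi> 0 = 0"
  using rep_add[of 0 0] by simp

lemma rep_diff: "\<pi> (a - b) = \<pi> a - \<pi> b"
  using rep_add[of "a - b" b] by simp

lemma rep_sum_mset: "\<pi> (\<Sum>x\<in>#M. f x) = (\<Sum>x\<in>#M. \<pi> (f x))"
  by (induction M) (simp_all add: rep_zero rep_add)

text \<open>
  Cancelling one letter on each side by the Toeplitz relation leaves an element of \<open>\<pi>(B)\<close> in the
  middle, which the next letter absorbs; this is the recursion of \<open>list_inner\<close>, whose
  accumulator is the element in the middle.
\<close>

lemma star_list_product_mult_list_product:
  assumes "length xs = length ys" "xs \<noteq> []" "set xs \<subseteq> vecs X" "set ys \<subseteq> vecs X"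
  shows "(list_product (map t xs))\<^sup>\<star> * (\<pi> b * list_product (map t ys)) = \<pi> (list_inner X b xs ys)"
  using assms
proof (induction xs ys arbitrary: b rule: list_induct2)
  case Nil
  then show ?case by simp
next
  case (Cons x xs y ys)
  have step: "(t x)\<^sup>\<star> * (\<pi> b * t y) = \<pi> (inner X x (lact X b y))"
    using Cons.prems by (simp add: t_lact[symmetric] star_t_mult_t lact_closed)
  show ?case
  proof (cases "xs = []")
    case True
    with Cons.hyps step show ?thesis by simp
  next
    case False
    then have ys: "ys \<noteq> []" using Cons.hyps by auto
    let ?P = "list_product (map t xs)" and ?Q = "list_product (map t ys)"
    have "(list_product (map t (x # xs)))\<^sup>\<star> * (\<pi> b * list_product (map t (y # ys))) =
        ?P\<^sup>\<star> * (((t x)\<^sup>\<star> * (\<pi> b * t y)) * ?Q)"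
      using False ys by (simp add: list_product_Cons star_mult mult.assoc)
    also have "\<dots> = ?P\<^sup>\<star> * (\<pi> (inner X x (lact X b y)) * ?Q)"
      by (simp only: step)
    also have "\<dots> = \<pi> (list_inner X (inner X x (lact X b y)) xs ys)"
      using False Cons.prems by (intro Cons.IH) auto
    finally show ?thesis by simp
  qed
qed

text \<open>
  The image of \<open>\<pi>\<close> need not contain a unit of the target algebra, but \<open>\<pi>(1)\<close> acts as one on words
  in \<open>t\<close>; this matches the accumulator with which \<open>formal_inner\<close> starts.
\<close>

lemma rep_1_mult_list_product:
  assumes "ys \<noteq> []" "set ys \<subseteq> vecs X"
  shows "\<pi> 1 * list_product (map t ys) = list_product (map t ys)"
proof (cases ys)
  case (Cons y zs)
  have "\<pi> 1 * t y = t y"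
    using assms(2) Cons t_lact[of y 1] by (simp add: lact_1)
  then show ?thesis
    using Cons by (cases zs) (simp_all add: mult.assoc[symmetric])
qed (use assms in simp)

abbreviation eval_sum :: "'x list multiset \<Rightarrow> 'c" where
  "eval_sum M \<equiv> \<Sum>xs\<in>#M. list_product (map t xs)"

lemma star_eval_sum_mult_eval_sum:
  assumes "M \<in> formal_tensors X k" "N \<in> formal_tensors X k" "k > 0"
  shows "(eval_sum M)\<^sup>\<star> * eval_sum N = \<pi> (formal_inner X M N)"
proof -
  have "(list_product (map t xs))\<^sup>\<star> * list_product (map t ys) = \<pi> (list_inner X 1 xs ys)"
    if "xs \<in># M" "ys \<in># N" for xs ys
  proof -
    have len: "length xs = k" "length ys = k" "set xs \<subseteq> vecs X" "set ys \<subseteq> vecs X"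
      using assms that by (auto simp: formal_tensors_def)
    then have "xs \<noteq> []" "ys \<noteq> []" using assms(3) by auto
    then show ?thesis
      using len star_list_product_mult_list_product[of xs ys 1] rep_1_mult_list_product[of ys]
      by simp
  qed
  then show ?thesis
    unfolding formal_inner_def star_sum_mset rep_sum_mset
    by (subst sum_mset.swap) (simp add: sum_mset_distrib_left sum_mset_distrib_right cong: image_mset_cong)
qed

text \<open>
  Well-definedness of the map that \<open>t\<close> induces on tensor powers: the difference of the values
  on two representatives satisfies \<open>d\<^sup>\<star> d = \<pi>(0) = 0\<close>.
\<close>

lemma power_map_tensor_class:
  assumes M: "M \<in> formal_tensors X k" and k: "k > 0"
  shows "power_map t (tensor_class X k M) = eval_sum M"
proof -
  have const: "eval_sum N = eval_sum M" if "N \<in> tensor_class X k M" for N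
  proof -
    have N: "N \<in> formal_tensors X k"
      and null: "formal_inner X M M - formal_inner X M N - formal_inner X N M + formal_inner X N N = 0"
      using that by (auto simp: tensor_class_def)
    have "(eval_sum M - eval_sum N)\<^sup>\<star> * (eval_sum M - eval_sum N) =
        (eval_sum M)\<^sup>\<star> * eval_sum M - (eval_sum M)\<^sup>\<star> * eval_sum N
          - (eval_sum N)\<^sup>\<star> * eval_sum M + (eval_sum N)\<^sup>\<star> * eval_sum N"
      by (simp add: star_diff algebra_simps)
    also have "\<dots> = \<pi> (formal_inner X M M - formal_inner X M N - formal_inner X N M
        + formal_inner X N N)"
      using M N k by (simp only: star_eval_sum_mult_eval_sum rep_diff rep_add)
    finally have "(eval_sum M - eval_sum N)\<^sup>\<star> * (eval_sum M - eval_sum N) = 0"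
      by (simp add: null rep_zero)
    then have "eval_sum M - eval_sum N = 0" by (rule star_mult_self_eq_0)
    then show ?thesis by simp
  qed
  have "M \<in> tensor_class X k M"
    using M by (simp add: tensor_class_def)
  moreover have "eval_sum ` tensor_class X k M = (\<lambda>_. eval_sum M) ` tensor_class X k M"
    using const by (rule image_cong[OF HOL.refl])
  ultimately have "eval_sum ` tensor_class X k M = {eval_sum M}"
    by (simp only: image_constant)
  then show ?thesis by (simp only: power_map_def the_elem_eq)
qed

text \<open>
  The last letter of the first word meets the first letter of the second, and \<open>\<pi>(p)\<close>
  moves across: \<open>t(\<zeta>) t(p \<cdot> x) = t(\<zeta> \<cdot> p) t(x)\<close>.
\<close>

lemma list_product_append_eq_0:
  assumes null: "\<And>\<zeta>. \<zeta> \<in> vecs X \<Longrightarrow> ract X \<zeta> p = 0"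
    and x: "x \<in> vecs X" and ys: "ys \<noteq> []" "set ys \<subseteq> vecs X"
  shows "list_product (map t ys) * list_product (map t (lact X p x # xs)) = 0"
proof -
  have t_0: "t 0 = 0"
    using t_scale[OF x, of 0] by simp
  have letters: "t \<zeta> * t (lact X p x) = 0" if "\<zeta> \<in> vecs X" for \<zeta>
  proof -
    have "t \<zeta> * t (lact X p x) = t (ract X \<zeta> p) * t x"
      using that x by (simp only: t_lact t_ract mult.assoc)
    with null[OF that] t_0 show ?thesis by simp
  qed
  have last: "t \<zeta> * list_product (map t (lact X p x # xs)) = 0" if "\<zeta> \<in> vecs X" for \<zeta>
    using letters[OF that]
    by (cases "xs = []") (simp_all add: list_product_Cons mult.assoc[symmetric])
  from ys show ?thesis
  proof (induction ys rule: list_nonempty_induct)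
    case (single y)
    then show ?case using last[of y] by simp
  next
    case (cons y ys)
    then have "list_product (map t (y # ys)) = t y * list_product (map t ys)"
      by (simp add: list_product_Cons)
    moreover have "list_product (map t ys) * list_product (map t (lact X p x # xs)) = 0"
      using cons.prems by (intro cons.IH) auto
    ultimately show ?case by (simp only: mult.assoc mult_zero_right)
  qed
qed

lemma non_returning_elementary:
  assumes null: "\<And>\<zeta>. \<zeta> \<in> vecs X \<Longrightarrow> ract X \<zeta> p = 0"
    and x: "x \<in> vecs X" and xs: "set xs \<subseteq> vecs X"
  shows "non_returning X t (Suc (length xs)) (elementary X (lact X p x # xs))"
proof -
  let ?zs = "lact X p x # xs"
  have mem: "{#?zs#} \<in> formal_tensors X (Suc (length xs))"
    using x xs by (simp add: formal_tensors_def lact_closed)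
  have val: "power_map t (elementary X ?zs) = list_product (map t ?zs)"
    using power_map_tensor_class[OF mem] by (simp add: elementary_def)
  have "power_map t \<eta> * power_map t (elementary X ?zs) = 0"
    if n: "n > 0" and \<eta>_power: "\<eta> \<in> tensor_power X n" for n \<eta>
  proof -
    obtain M where M: "M \<in> formal_tensors X n" and \<eta>: "\<eta> = tensor_class X n M"
      using \<eta>_power by (auto simp: tensor_power_def)
    have "list_product (map t ys) * list_product (map t ?zs) = 0" if "ys \<in># M" for ys
      using M n that by (intro list_product_append_eq_0 null x) (auto simp: formal_tensors_def)
    then have "eval_sum M * list_product (map t ?zs) = 0"
      by (simp add: sum_mset_distrib_right cong: image_mset_cong)
    then show ?thesis
      using power_map_tensor_class[OF M n] by (simp only: \<eta> val)
  qed
  then have "(power_map t (elementary X ?zs))\<^sup>\<star> * power_map t \<eta> * power_map t (elementary X ?zs) = 0"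
    if "n > 0" "\<eta> \<in> tensor_power X n" for n \<eta>
    using that by (simp only: mult.assoc mult_zero_right)
  moreover have "elementary X ?zs \<in> tensor_power X (Suc (length xs))"
    using mem by (simp add: elementary_def tensor_power_def)
  ultimately show ?thesis
    unfolding non_returning_def by blast
qed

end

theorem proposition3p3:
  fixes \<delta> :: real
    and \<psi> :: "'b::unital_cstar_algebra \<Rightarrow> complex"
    and A :: "'b \<Rightarrow> 'b"
    and p :: 'b
    and \<pi> :: "'b \<Rightarrow> 'c::cstar_algebra"
    and t :: "('b, 'b) tensor \<Rightarrow> 'c"
    and m :: nat
  defines "\<epsilon> \<equiv> edge_vector \<delta> \<psi> A"
    and "E \<equiv> edge_correspondence \<delta> \<psi> A"
  assumes graph: "finite_quantum_graph \<delta> \<psi> A"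
    and cp: "completely_positive A"
    and central: "central_projection p"
    and orthogonal: "\<And>x. p * A x = 0"
    and universal: "universal_covariant_representation E \<pi> t"
    and m: "m > 0"
  shows "non_returning E t m (elementary E (lact E p \<epsilon> # replicate (m - 1) \<epsilon>))"
proof -
  have "clinear A"
    using graph by (simp add: finite_quantum_graph_def schur_idempotent_def)
  then have null: "ract E \<zeta> p = 0" if "\<zeta> \<in> vecs E" for \<zeta>
    using ract_edge_correspondence_eq_0 central orthogonal that unfolding E_def by blast
  interpret unital_toeplitz_representation E \<pi> t
  proof
    show "toeplitz_representation E class_struct \<pi> t"
      using universal
      by (simp add: universal_covariant_representation_def covariant_representation_def)
    show "lact E b \<zeta> \<in> vecs E" if "\<zeta> \<in> vecs E" for b \<zeta>
      using that unfolding E_def by (rule lact_in_edge_correspondence)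
    show "lact E 1 \<zeta> = \<zeta>" for \<zeta>
      by (simp add: E_def lact_edge_correspondence lact_one)
  qed
  have "\<epsilon> \<in> vecs E"
    unfolding \<epsilon>_def E_def by (rule edge_vector_in_edge_correspondence)
  then have "non_returning E t (Suc (length (replicate (m - 1) \<epsilon>)))
      (elementary E (lact E p \<epsilon> # replicate (m - 1) \<epsilon>))"
    by (intro non_returning_elementary null) auto
  then show ?thesis using m by simp
qed

end
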